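(* Let $(X,d)$ be a metric space with integer-valued metric satisfying the local rank condition (LRC). Let $\mathcal{S}$ be the family of all $d$-splits of $X$, so that $d=d_0+\sum_{S\in\mathcal{S}}\alpha_S\delta_S$ with $\alpha_S=\alpha^d_S$ and $d_0$ a split-prime pseudometric, and let $\lambda_S\in[0,\alpha_S]$ for every $S\in\mathcal{S}$. Then, setting $d_1:=d-\sum_{S\in\mathcal{S}}\lambda_S\delta_S$, we have $$\mathrm{E}(X,d)\subset\mathbb{R}^X\cap\Bigl(\mathrm{E}(X,d_1)+\sum_{S\in\mathcal{S}}\lambda_S\,\mathrm{E}(X,\delta_S)\Bigr).$$ Moreover, for any split $S=\{A,B\}$ of $X$, any $\lambda_S>0$ and any pseudometric $d_1$ on $X$ such that $d=d_1+\lambda_S\delta_S$: if $\mathrm{E}(X,d)\subset\mathrm{E}(X,d_1)+\lambda_S\mathrm{E}(X,\delta_S)$, then (i) $S$ is a $d$-split of $X$, and (ii) $\lambda_S\le\alpha_S$.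
   Context: Splits. A split of a set $X$ is an unordered pair $S=\{A,B\}$ of non-empty subsets with $X=A\sqcup B$; $\delta_S(x,y)=1$ if $x,y$ lie in different parts of $S$, and $0$ otherwise. For a pseudometric $d$ on $X$, the isolation index of a pair $S=\{A,B\}$ of non-empty subsets is $$\alpha^d_S=\tfrac12\inf_{a,a'\in A,\;b,b'\in B}\bigl[\max\{d(a,b)+d(a',b'),\,d(a',b)+d(a,b'),\,d(a,a')+d(b,b')\}-d(a,a')-d(b,b')\bigr].$$ $S$ is a $d$-split if $\alpha^d_S>0$; a pseudometric is split-prime if all splits of $X$ have isolation index $0$ with respect to it. For integer-valued $d$ any two points are separated by only finitely many $d$-splits, $d_1$ as in the first part is a pseudometric, and a decomposition $d=d_0+\sum_{S\in\mathcal{S}}\alpha_S\delta_S$ with $d_0$ a split-prime pseudometric exists. Injective hull. For a pseudometric $d$: $\Delta(X,d)=\{f\in\mathbb{R}^X: f(x)+f(y)\ge d(x,y)\ \forall x,y\}$ and $\mathrm{E}(X,d)=\{f\in\mathbb{R}^X: f(x)=\sup_{y\in X}(d(x,y)-f(y))\ \forall x\in X\}$. Put $A(f)=\{\{x,y\}: f(x)+f(y)=d(x,y)\}$ ($x=y$ allowed), $\mathrm{E}'(X,d)=\{f\in\Delta(X,d):\bigcup A(f)=X\}$, $H(A)=\{g\in\mathbb{R}^X: g(x)+g(y)=d(x,y)\ \forall\{x,y\}\in A\}$, $\mathrm{rank}(A)=\dim H(A)$. (LRC): for every $f\in\mathrm{E}(X,d)$ there are $\varepsilon,N>0$ such that $\mathrm{rank}(A(g))\le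 N$ for all $g\in\mathrm{E}'(X,d)$ with $\|f-g\|_\infty<\varepsilon$. Sums of sets. $\mathrm{E}(X,d_1)+\sum_{S}\lambda_S\mathrm{E}(X,\delta_S)$ is the set of all functions $f_1+\sum_S\lambda_Sf_S\in[0,\infty]^X$ (pointwise sums of non-negative terms) with $f_1\in\mathrm{E}(X,d_1)$, $f_S\in\mathrm{E}(X,\delta_S)$; since $\mathcal{S}$ may be infinite, one intersects with $\mathbb{R}^X$. *)

theory Defs
  imports "HOL-Analysis.Analysis" "HOL-Library.Function_Algebras"
begin

text \<open>The underlying set \<open>X\<close> is the universe of the type \<open>'a\<close>, so that
  the functions in \<open>\<real>\<^sup>X\<close> are the total functions \<open>'a \<Rightarrow> real\<close>.\<close>

definition pseudometric :: "('a \<Rightarrow> 'a \<Rightarrow> real) \<Rightarrow> bool" where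
  "pseudometric d \<longleftrightarrow>
     (\<forall>x. d x x = 0) \<and> (\<forall>x y. 0 \<le> d x y) \<and> (\<forall>x y. d x y = d y x) \<and>
     (\<forall>x y z. d x z \<le> d x y + d y z)"

subsection \<open>Splits\<close>

text \<open>The unordered pair \<open>{A, B}\<close> is a set of sets.\<close>

definition is_split :: "'a set set \<Rightarrow> bool" where
  "is_split S \<longleftrightarrow>
     (\<exists>A B. S = {A, B} \<and> A \<noteq> {} \<and> B \<noteq> {} \<and> A \<inter> B = {} \<and> A \<union> B = UNIV)"

definition split_dist :: "'a set set \<Rightarrow> 'a \<Rightarrow> 'a \<Rightarrow> real" where
  "split_dist S x y = (if \<exists>A\<in>S. \<exists>B\<in>S. A \<noteq> B \<and> x \<in> A \<and> y \<in> B then 1 else 0)"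

text \<open>The expression is symmetric in the two members of the pair, so letting \<open>(A, B)\<close>
  run over both orderings of \<open>S\<close> does not change the infimum.  The infimum
  is over a set of reals that is bounded below by \<open>0\<close>, because the maximum includes
  \<open>d a a' + d b b'\<close>.\<close>

definition isolation_index :: "('a \<Rightarrow> 'a \<Rightarrow> real) \<Rightarrow> 'a set set \<Rightarrow> real" where
  "isolation_index d S = 1/2 * Inf
     {Max {d a b + d a' b', d a' b + d a b', d a a' + d b b'} - d a a' - d b b' | A B a a' b b'.
        S = {A, B} \<and> a \<in> A \<and> a' \<in> A \<and> b \<in> B \<and> b' \<in> B}"

definition d_split :: "('a \<Rightarrow> 'a \<Rightarrow> real) \<Rightarrow> 'a set set \<Rightarrow> bool" where
  "d_split d S \<longleftrightarrow> is_split S \<and> isolation_index d S > 0"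

definition split_prime :: "('a \<Rightarrow> 'a \<Rightarrow> real) \<Rightarrow> bool" where
  "split_prime d \<longleftrightarrow> pseudometric d \<and> (\<forall>S. is_split S \<longrightarrow> isolation_index d S = 0)"

subsection \<open>Injective hulls\<close>

definition Delta :: "('a \<Rightarrow> 'a \<Rightarrow> real) \<Rightarrow> ('a \<Rightarrow> real) set" where
  "Delta d = {f. \<forall>x y. f x + f y \<ge> d x y}"

text \<open>The supremum is taken in the extended reals, so the equation also
  says that it is finite.\<close>

definition inj_hull :: "('a \<Rightarrow> 'a \<Rightarrow> real) \<Rightarrow> ('a \<Rightarrow> real) set" where
  "inj_hull d = {f. \<forall>x. ereal (f x) = (SUP y. ereal (d x y - f y))}"

definition tight_pairs :: "('a \<Rightarrow> 'a \<Rightarrow> real) \<Rightarrow> ('a \<Rightarrow> real) \<Rightarrow> 'a set set" where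
  "tight_pairs d f = {{x, y} | x y. f x + f y = d x y}"

definition inj_hull' :: "('a \<Rightarrow> 'a \<Rightarrow> real) \<Rightarrow> ('a \<Rightarrow> real) set" where
  "inj_hull' d = {f \<in> Delta d. \<Union>(tight_pairs d f) = UNIV}"

definition tight_space :: "('a \<Rightarrow> 'a \<Rightarrow> real) \<Rightarrow> 'a set set \<Rightarrow> ('a \<Rightarrow> real) set" where
  "tight_space d A = {g. \<forall>x y. {x, y} \<in> A \<longrightarrow> g x + g y = d x y}"

global_interpretation real_fun: vector_space "\<lambda>(c::real) (f::'a \<Rightarrow> real) x. c * f x"
  defines real_fun_span = real_fun.span
    and real_fun_dim = real_fun.dim
  by unfold_locales (auto simp: fun_eq_iff algebra_simps)

text \<open>The dimension of the affine space \<open>H(A)\<close>, i.e. that of its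
  space of differences.  The library dimension is a natural number and does not detect
  infinite dimension, which is therefore treated separately.
  The empty set gets dimension \<open>0\<close>, but \<open>H(A(f))\<close> always contains \<open>f\<close>.\<close>

definition tight_rank :: "('a \<Rightarrow> 'a \<Rightarrow> real) \<Rightarrow> 'a set set \<Rightarrow> enat" where
  "tight_rank d A =
     (let V = {g - h | g h. g \<in> tight_space d A \<and> h \<in> tight_space d A}
      in if \<exists>B. finite B \<and> V \<subseteq> real_fun_span B then enat (real_fun_dim V) else \<infinity>)"

definition sup_dist :: "('a \<Rightarrow> real) \<Rightarrow> ('a \<Rightarrow> real) \<Rightarrow> ereal" where
  "sup_dist f g = (SUP x. ereal \<bar>f x - g x\<bar>)"

definition local_rank_condition :: "('a \<Rightarrow> 'a \<Rightarrow> real) \<Rightarrow> bool" where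
  "local_rank_condition d \<longleftrightarrow>
     (\<forall>f \<in> inj_hull d. \<exists>(\<epsilon>::real) (N::nat). \<epsilon> > 0 \<and> N > 0 \<and>
        (\<forall>g \<in> inj_hull' d. sup_dist f g < ereal \<epsilon> \<longrightarrow> tight_rank d (tight_pairs d g) \<le> enat N))"

subsection \<open>Sums of injective hulls\<close>

text \<open>Members of an injective hull of a pseudometric are non-negative
  (\<open>2 f x \<ge> d x x = 0\<close>), so \<open>ennreal\<close> in the next definition does not truncate when
  the coefficients \<open>l S\<close> are non-negative.\<close>

definition hull_sum ::
  "('a \<Rightarrow> 'a \<Rightarrow> real) \<Rightarrow> 'a set set set \<Rightarrow> ('a set set \<Rightarrow> real) \<Rightarrow> ('a \<Rightarrow> ennreal) set" where
  "hull_sum d1 \<S> l =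
     {\<lambda>x. ennreal (f1 x) + (\<Sum>\<^sub>\<infinity>S\<in>\<S>. ennreal (l S) * ennreal (f S x)) | f1 f.
        f1 \<in> inj_hull d1 \<and> (\<forall>S\<in>\<S>. f S \<in> inj_hull (split_dist S))}"

text \<open>The intersection of \<open>\<real>\<^sup>X\<close> with a subset of \<open>[0,\<infinity>]\<^sup>X\<close>.\<close>

definition real_functions_in :: "('a \<Rightarrow> ennreal) set \<Rightarrow> ('a \<Rightarrow> real) set" where
  "real_functions_in F = {f. (\<forall>x. 0 \<le> f x) \<and> (\<lambda>x. ennreal (f x)) \<in> F}"

end

theory Submission
  imports Defs
begin

text \<open>Subtracting \<open>\<lambda>\<delta>\<^sub>S\<close> with \<open>\<lambda> \<le> \<alpha>\<^sub>S\<close> from \<open>d\<close> does not change the isolation index of any other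
  \<open>d\<close>-split, by an inequality on five points, so splits can be subtracted one at a time.
  For integer-valued \<open>d\<close>, isolation indices are attained and positive ones are at least \<open>1/2\<close>, hence
  two points are separated by finitely many \<open>d\<close>-splits and, on finitely many points, subtracting all
  splits amounts to subtracting finitely many.

  For \<open>f \<in> E(X, d)\<close> and a single \<open>d\<close>-split \<open>S\<close> there is some \<open>f\<^sub>S \<in> E(X, \<delta>\<^sub>S)\<close>, given by a
  number \<open>t \<in> [0,1]\<close>, with \<open>f - \<lambda>f\<^sub>S \<in> \<Delta>(X, d - \<lambda>\<delta>\<^sub>S)\<close>; finitely many splits are handled by induction
  and all of them by compactness of \<open>[0,1]\<^sup>\<S>\<close>. The remainder \<open>f\<^sub>1\<close> is automatically extremal, because
  \<open>f\<^sub>S x + f\<^sub>S y \<ge> \<delta>\<^sub>S(x, y)\<close> gives \<open>f\<^sub>1 x + f\<^sub>1 y - d\<^sub>1(x, y) \<le> f x + f y - d(x, y)\<close>.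

  For the converse, on any four points \<open>a, a' \<in> A\<close> and \<open>b, b' \<in> B\<close> some \<open>f \<in> E(X, d)\<close> has
  \<open>f a + f a' + f b + f b'\<close> equal to the largest of the three sums of two distances; comparing its
  decomposition with \<open>d\<^sub>1(a, a') + d\<^sub>1(b, b') = d(a, a') + d(b, b')\<close> bounds \<open>\<lambda>\<^sub>S\<close>.\<close>

subsection \<open>Isolation of splits\<close>

text \<open>A split is handled through one of its sides. Exchanging \<open>A\<close> and
  \<open>- A\<close> does not change the value, so the choice of side is harmless.\<close>

definition cut_dist :: "'a set \<Rightarrow> 'a \<Rightarrow> 'a \<Rightarrow> real" where
  "cut_dist A x y = of_bool ((x \<in> A) \<noteq> (y \<in> A))"

lemma is_splitE:
  assumes "is_split S"
  obtains A where "S = {A, - A}" "A \<noteq> {}" "- A \<noteq> {}" "split_dist S = cut_dist A"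
proof -
  from assms obtain A B where S: "S = {A, B}" "A \<noteq> {}" "B \<noteq> {}" "A \<inter> B = {}" "A \<union> B = UNIV"
    unfolding is_split_def by blast
  then have B: "B = - A" by auto
  have "split_dist S x y = cut_dist A x y" for x y
    using S(2,3) unfolding split_dist_def cut_dist_def S(1) B by auto
  then show ?thesis using that[of A] S B by (simp add: fun_eq_iff)
qed

definition gap :: "('a \<Rightarrow> 'a \<Rightarrow> real) \<Rightarrow> 'a \<Rightarrow> 'a \<Rightarrow> 'a \<Rightarrow> 'a \<Rightarrow> real" where
  "gap d a a' b b' =
     max (d a b + d a' b') (max (d a' b + d a b') (d a a' + d b b')) - d a a' - d b b'"

text \<open>A lower bound \<open>c\<close> on the isolation index without the third sum of the
  maximum: for positive \<open>c\<close> the sum \<open>d a a' + d b b'\<close> cannot be the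
  largest. The equivalences make the condition symmetric in \<open>A\<close> and \<open>- A\<close>,
  so the same fact applies with either side in front.\<close>

definition isolated :: "('a \<Rightarrow> 'a \<Rightarrow> real) \<Rightarrow> 'a set \<Rightarrow> real \<Rightarrow> bool" where
  "isolated d A c \<longleftrightarrow>
     (\<forall>a a' b b'. (a \<in> A \<longleftrightarrow> a' \<in> A) \<and> (b \<in> A \<longleftrightarrow> b' \<in> A) \<and> (a \<in> A \<longleftrightarrow> b \<notin> A) \<longrightarrow>
        2 * c + d a a' + d b b' \<le> max (d a b + d a' b') (d a' b + d a b'))"

lemma isolatedD:
  assumes "isolated d A c" "a \<in> A \<longleftrightarrow> a' \<in> A" "b \<in> A \<longleftrightarrow> b' \<in> A" "a \<in> A \<longleftrightarrow> b \<notin> A"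
  shows "2 * c + d a a' + d b b' \<le> max (d a b + d a' b') (d a' b + d a b')"
  using assms unfolding isolated_def by blast

lemma gap_nonneg: "0 \<le> gap d a a' b b'"
  by (simp add: gap_def)

definition gaps :: "('a \<Rightarrow> 'a \<Rightarrow> real) \<Rightarrow> 'a set \<Rightarrow> real set" where
  "gaps d A = {gap d a a' b b' | a a' b b'. a \<in> A \<and> a' \<in> A \<and> b \<notin> A \<and> b' \<notin> A}"

text \<open>The definition runs over both orderings of the pair, but exchanging \<open>a, a'\<close>
  with \<open>b, b'\<close> preserves \<open>gap\<close>, so one ordering gives all values.\<close>

lemma isolation_index_eq:
  assumes "S = {A, - A}" and sym: "\<And>x y. d x y = d y x"
  shows "isolation_index d S =
    1/2 * Inf (gaps d A)"
proof -
  have *: "S = {A', B'} \<longleftrightarrow> A' = A \<and> B' = - A \<or> A' = - A \<and> B' = A" for A' B'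
    unfolding assms(1) doubleton_eq_iff by blast
  have swap: "gap d b b' a a' = gap d a a' b b'" for a a' b b'
    unfolding gap_def using sym[of b a] sym[of b' a'] sym[of b' a] sym[of b a'] by (simp add: ac_simps)
  have "{Max {d a b + d a' b', d a' b + d a b', d a a' + d b b'} - d a a' - d b b' | A B a a' b b'.
        S = {A, B} \<and> a \<in> A \<and> a' \<in> A \<and> b \<in> B \<and> b' \<in> B}
     = {gap d a a' b b' | A B a a' b b'. S = {A, B} \<and> a \<in> A \<and> a' \<in> A \<and> b \<in> B \<and> b' \<in> B}"
    by (simp add: gap_def)
  also have "\<dots> = {gap d a a' b b' | a a' b b'. a \<in> A \<and> a' \<in> A \<and> b \<notin> A \<and> b' \<notin> A}"
    (is "?L = ?R")
  proof
    show "?L \<subseteq> ?R"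
    proof
      fix v assume "v \<in> ?L"
      then obtain A' B' a a' b b' where v: "v = gap d a a' b b'" "S = {A', B'}" "a \<in> A'" "a' \<in> A'"
        "b \<in> B'" "b' \<in> B'" by blast
      from v(2) consider "A' = A" "B' = - A" | "A' = - A" "B' = A" unfolding * by blast
      then show "v \<in> ?R"
      proof cases
        case 1
        then show ?thesis using v by blast
      next
        case 2
        then have "v = gap d b b' a a'" "b \<in> A" "b' \<in> A" "a \<notin> A" "a' \<notin> A"
          using v swap by auto
        then show ?thesis by blast
      qed
    qed
    show "?R \<subseteq> ?L"
      using assms(1) by blast
  qed
  finally show ?thesis unfolding isolation_index_def gaps_def by simp
qed

lemma gaps_nonneg: "v \<in> gaps d A \<Longrightarrow> 0 \<le> v"
  unfolding gaps_def using gap_nonneg by clarify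

lemma gaps_nonempty: "A \<noteq> {} \<Longrightarrow> - A \<noteq> {} \<Longrightarrow> gaps d A \<noteq> {}"
  unfolding gaps_def by blast

lemma bdd_below_gaps: "bdd_below (gaps d A)"
  by (rule bdd_belowI[of _ 0]) (rule gaps_nonneg)

lemma isolation_index_nonneg:
  assumes "is_split S" "\<And>x y. d x y = d y x"
  shows "0 \<le> isolation_index d S"
proof -
  obtain A where A: "S = {A, - A}" "A \<noteq> {}" "- A \<noteq> {}"
    using assms(1) by (elim is_splitE)
  have "0 \<le> Inf (gaps d A)"
    using A gaps_nonneg by (intro cInf_greatest gaps_nonempty)
  then show ?thesis using isolation_index_eq[where d = d, OF A(1) assms(2)] by simp
qed

lemma le_isolation_index_iff:
  assumes A: "S = {A, - A}" "A \<noteq> {}" "- A \<noteq> {}" and sym: "\<And>x y. d x y = d y x" and c: "0 < c"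
  shows "c \<le> isolation_index d S \<longleftrightarrow> isolated d A c"
proof -
  let ?V = "gaps d A"
  have "c \<le> isolation_index d S \<longleftrightarrow> 2 * c \<le> Inf ?V"
    using isolation_index_eq[where d = d, OF A(1) sym] by auto
  also have "\<dots> \<longleftrightarrow> (\<forall>v\<in>?V. 2 * c \<le> v)"
    using le_cInf_iff[OF gaps_nonempty[OF A(2,3)] bdd_below_gaps] .
  also have "\<dots> \<longleftrightarrow> isolated d A c"
  proof
    assume *: "\<forall>v\<in>?V. 2 * c \<le> v"
    have main: "2 * c + d a a' + d b b' \<le> max (d a b + d a' b') (d a' b + d a b')"
      if "a \<in> A" "a' \<in> A" "b \<notin> A" "b' \<notin> A" for a a' b b'
    proof -
      have "2 * c \<le> gap d a a' b b'" using * that unfolding gaps_def by blast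
      then show ?thesis using c by (auto simp: gap_def max_def split: if_splits)
    qed
    show "isolated d A c"
      unfolding isolated_def
    proof (intro allI impI)
      fix a a' b b'
      assume h: "(a \<in> A \<longleftrightarrow> a' \<in> A) \<and> (b \<in> A \<longleftrightarrow> b' \<in> A) \<and> (a \<in> A \<longleftrightarrow> b \<notin> A)"
      show "2 * c + d a a' + d b b' \<le> max (d a b + d a' b') (d a' b + d a b')"
      proof (cases "a \<in> A")
        case True
        then show ?thesis using main h by blast
      next
        case False
        then have "2 * c + d b b' + d a a' \<le> max (d b a + d b' a') (d b' a + d b a')"
          using main h by blast
        then show ?thesis using sym[of b a] sym[of b' a'] sym[of b' a] sym[of b a']
          by (simp add: ac_simps)
      qed
    qed
  next
    assume *: "isolated d A c"
    show "\<forall>v\<in>?V. 2 * c \<le> v"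
    proof
      fix v assume "v \<in> ?V"
      then obtain a a' b b' where v: "v = gap d a a' b b'" "a \<in> A" "a' \<in> A" "b \<notin> A" "b' \<notin> A"
        unfolding gaps_def by blast
      then show "2 * c \<le> v"
        using isolatedD[OF *, of a a' b b'] by (simp add: gap_def max_def split: if_splits)
    qed
  qed
  finally show ?thesis .
qed

lemma cut_dist_sym: "cut_dist A x y = cut_dist A y x"
  by (auto simp: cut_dist_def)

text \<open>Degenerate quadruples of \<open>isolated\<close> give the slack: \<open>x, x\<close>
  against \<open>y, y\<close> yields \<open>c \<le> d x y\<close>, and \<open>x, z\<close> against
  \<open>y, y\<close> yields \<open>2 * c + d x z \<le> d x y + d y z\<close>. For every other
  position of three points the two sides of the triangle inequality lose the same amount.\<close>

lemma pseudometric_subtract_cut: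
  assumes d: "pseudometric d" and iso: "isolated d A c" and l: "0 \<le> l" "l \<le> c"
  shows "pseudometric (\<lambda>x y. d x y - l * cut_dist A x y)"
proof -
  have d': "d x x = 0" "0 \<le> d x y" "d x y = d y x" "d x z \<le> d x y + d y z" for x y z
    using d by (auto simp: pseudometric_def)
  have pos: "l \<le> d x y" if "x \<in> A \<longleftrightarrow> y \<notin> A" for x y
    using isolatedD[OF iso, of x x y y] that d'(1) l by auto
  have tri: "2 * l + d x z \<le> d x y + d y z" if "x \<in> A \<longleftrightarrow> y \<notin> A" "z \<in> A \<longleftrightarrow> y \<notin> A" for x y z
    using isolatedD[OF iso, of x z y y] that d'(1) d'(3)[of z y] l by auto
  have "d x z - l * cut_dist A x z \<le> (d x y - l * cut_dist A x y) + (d y z - l * cut_dist A y z)" for x y z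
    using tri[of x y z] d'(4)[of x z y] l by (auto simp: cut_dist_def)
  moreover have "0 \<le> d x y - l * cut_dist A x y" for x y
    using pos[of x y] d'(2)[of x y] by (auto simp: cut_dist_def)
  moreover have "d x x - l * cut_dist A x x = 0" for x
    by (simp add: cut_dist_def d')
  moreover have "d x y - l * cut_dist A x y = d y x - l * cut_dist A y x" for x y
    using d'(3)[of x y] cut_dist_sym[of A x y] by simp
  ultimately show ?thesis unfolding pseudometric_def by blast
qed

text \<open>Either the cut divides the four points two against two, in one of three ways, or it
  leaves at most one point on one side; then its three sums of two distances agree and subtracting
  it shifts all three sums of \<open>d\<close> equally.\<close>

lemma cut_dist_quadruple_cases:
  obtains (across) "a \<in> A \<longleftrightarrow> a' \<in> A" "b \<in> A \<longleftrightarrow> b' \<in> A" "a \<in> A \<longleftrightarrow> b \<notin> A"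
  | (first) "a \<in> A \<longleftrightarrow> b \<in> A" "a' \<in> A \<longleftrightarrow> b' \<in> A" "a \<in> A \<longleftrightarrow> a' \<notin> A"
  | (second) "a \<in> A \<longleftrightarrow> b' \<in> A" "a' \<in> A \<longleftrightarrow> b \<in> A" "a \<in> A \<longleftrightarrow> a' \<notin> A"
  | (level) "cut_dist A a b + cut_dist A a' b' = cut_dist A a a' + cut_dist A b b'"
            "cut_dist A a' b + cut_dist A a b' = cut_dist A a a' + cut_dist A b b'"
  by (cases "a \<in> A"; cases "a' \<in> A"; cases "b \<in> A"; cases "b' \<in> A") (simp_all add: cut_dist_def)

text \<open>When the cut pairs the points as in \<open>first\<close> or \<open>second\<close>, the
  only sum it leaves unchanged is at least \<open>2 * c\<close> below the maximum. Hence the maximum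
  and the subtracted sum both drop by \<open>2 * l\<close>, and the gap stays the same.\<close>

lemma gap_subtract_cut:
  assumes iso: "isolated d A c" and l: "0 \<le> l" "l \<le> c" and sym: "\<And>x y. d x y = d y x"
  shows "gap (\<lambda>x y. d x y - l * cut_dist A x y) a a' b b' \<le> gap d a a' b b'"
proof (cases rule: cut_dist_quadruple_cases[where A=A and a=a and a'=a' and b=b and b'=b'])
  case across
  then have "cut_dist A a b = 1" "cut_dist A a' b' = 1" "cut_dist A a' b = 1" "cut_dist A a b' = 1"
    "cut_dist A a a' = 0" "cut_dist A b b' = 0" by (auto simp: cut_dist_def)
  then show ?thesis using l unfolding gap_def by simp linarith
next
  case first
  then have "cut_dist A a b = 0" "cut_dist A a' b' = 0" "cut_dist A a' b = 1" "cut_dist A a b' = 1"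
    "cut_dist A a a' = 1" "cut_dist A b b' = 1" by (auto simp: cut_dist_def)
  then show ?thesis using isolatedD[OF iso, of a b a' b'] first l sym[of b a']
    by (simp add: gap_def)
next
  case second
  then have "cut_dist A a b = 1" "cut_dist A a' b' = 1" "cut_dist A a' b = 0" "cut_dist A a b' = 0"
    "cut_dist A a a' = 1" "cut_dist A b b' = 1" by (auto simp: cut_dist_def)
  then show ?thesis using isolatedD[OF iso, of a b' a' b] second l sym[of b' a'] sym[of b' b]
    by (simp add: gap_def)
next
  case level
  then have "l * cut_dist A a b + l * cut_dist A a' b' = l * cut_dist A a a' + l * cut_dist A b b'"
    "l * cut_dist A a' b + l * cut_dist A a b' = l * cut_dist A a a' + l * cut_dist A b b'"
    by (simp_all flip: distrib_left)
  then show ?thesis unfolding gap_def by linarith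
qed

lemma gap_subtract_own_cut:
  assumes "isolated d A c" "0 \<le> l" "l \<le> c" "a \<in> A" "a' \<in> A" "b \<notin> A" "b' \<notin> A"
  shows "gap (\<lambda>x y. d x y - l * cut_dist A x y) a a' b b' = gap d a a' b b' - 2 * l"
  using isolatedD[OF assms(1), of a a' b b'] assms(2-)
  by (simp add: gap_def cut_dist_def)

text \<open>Here \<open>A\<close> separates \<open>a, a'\<close> from \<open>x, b, b'\<close>, and
  \<open>B\<close> separates \<open>a, a', x\<close> from \<open>b, b'\<close>. Each cut is applied
  to two quadruples through \<open>x\<close>. Whichever terms attain the four maxima, either two of
  the inequalities or all four add up so that the distances to \<open>x\<close> cancel; in the
  latter case the maximum is bounded below by the average of the two sums.\<close>

lemma five_point_inequality:
  assumes S: "isolated d A \<alpha>" and T: "isolated d B \<beta>"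
    and "a \<in> A \<longleftrightarrow> a' \<in> A" "b \<in> A \<longleftrightarrow> b' \<in> A" "a \<in> A \<longleftrightarrow> b \<notin> A"
    and "a \<in> B \<longleftrightarrow> a' \<in> B" "b \<in> B \<longleftrightarrow> b' \<in> B" "a \<in> B \<longleftrightarrow> b \<notin> B"
    and "x \<in> A \<longleftrightarrow> b \<in> A" "x \<in> B \<longleftrightarrow> a \<in> B"
  shows "2 * \<alpha> + 2 * \<beta> + d a a' + d b b' \<le> max (d a b + d a' b') (d a' b + d a b')"
proof -
  have 1: "2 * \<alpha> + d a a' + d x b \<le> max (d a x + d a' b) (d a' x + d a b)"
    using isolatedD[OF S, of a a' x b] assms(3-) by blast
  have 2: "2 * \<alpha> + d a a' + d x b' \<le> max (d a x + d a' b') (d a' x + d a b')"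
    using isolatedD[OF S, of a a' x b'] assms(3-) by blast
  have 3: "2 * \<beta> + d a x + d b b' \<le> max (d a b + d x b') (d x b + d a b')"
    using isolatedD[OF T, of a x b b'] assms(3-) by blast
  have 4: "2 * \<beta> + d a' x + d b b' \<le> max (d a' b + d x b') (d x b + d a' b')"
    using isolatedD[OF T, of a' x b b'] assms(3-) by blast
  show ?thesis using 1 2 3 4 unfolding le_max_iff_disj by (elim disjE) linarith+
qed

text \<open>The critical case is \<open>across\<close>, where subtracting the cut \<open>A\<close>
  lowers both sums on the right and nothing on the left. As \<open>A\<close> and \<open>B\<close>
  give different splits, the five-point inequality provides \<open>2 * \<alpha>\<close> of extra
  room.\<close>

lemma isolated_subtract_cut:
  assumes sym: "\<And>x y. d x y = d y x"
    and S: "isolated d A \<alpha>" and T: "isolated d B \<beta>"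
    and ne: "A \<noteq> B" "A \<noteq> - B" and l: "0 \<le> l" "l \<le> \<alpha>" and pos: "0 < \<beta>"
  shows "isolated (\<lambda>x y. d x y - l * cut_dist A x y) B \<beta>"
  unfolding isolated_def
proof (intro allI impI)
  let ?d = "\<lambda>x y. d x y - l * cut_dist A x y"
  fix a a' b b'
  assume h: "(a \<in> B \<longleftrightarrow> a' \<in> B) \<and> (b \<in> B \<longleftrightarrow> b' \<in> B) \<and> (a \<in> B \<longleftrightarrow> b \<notin> B)"
  then have T': "2 * \<beta> + d a a' + d b b' \<le> max (d a b + d a' b') (d a' b + d a b')"
    using isolatedD[OF T, of a a' b b'] by blast
  show "2 * \<beta> + ?d a a' + ?d b b' \<le> max (?d a b + ?d a' b') (?d a' b + ?d a b')"
  proof (cases rule: cut_dist_quadruple_cases[where A=A and a=a and a'=a' and b=b and b'=b'])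
    case across
    \<comment> \<open>The two cuts place \<open>x\<close> differently relative to \<open>a\<close>.
      Up to exchanging the pairs \<open>a, a'\<close> and \<open>b, b'\<close>, this is the fifth
      point.\<close>
    obtain x where "(x \<in> A \<longleftrightarrow> a \<in> A) \<noteq> (x \<in> B \<longleftrightarrow> a \<in> B)"
      using ne by blast
    then consider "x \<in> A \<longleftrightarrow> b \<in> A" "x \<in> B \<longleftrightarrow> a \<in> B" | "x \<in> A \<longleftrightarrow> a \<in> A" "x \<in> B \<longleftrightarrow> b \<in> B"
      using across h by blast
    then have "2 * \<alpha> + 2 * \<beta> + d a a' + d b b' \<le> max (d a b + d a' b') (d a' b + d a b')"
    proof cases
      case 1
      then show ?thesis using five_point_inequality[OF S T, of a a' b b' x] across h by blast
    next
      case 2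
      then have "2 * \<alpha> + 2 * \<beta> + d b b' + d a a' \<le> max (d b a + d b' a') (d b' a + d b a')"
        using five_point_inequality[OF S T, of b b' a a' x] across h by blast
      then show ?thesis using sym[of b a] sym[of b' a'] sym[of b' a] sym[of b a']
        by (simp add: ac_simps)
    qed
    moreover have "cut_dist A a b = 1" "cut_dist A a' b' = 1" "cut_dist A a' b = 1"
      "cut_dist A a b' = 1" "cut_dist A a a' = 0" "cut_dist A b b' = 0"
      using across by (auto simp: cut_dist_def)
    ultimately show ?thesis using l by simp
  next
    case first
    then have "cut_dist A a b = 0" "cut_dist A a' b' = 0" "cut_dist A a' b = 1"
      "cut_dist A a b' = 1" "cut_dist A a a' = 1" "cut_dist A b b' = 1"
      by (auto simp: cut_dist_def)
    then show ?thesis using isolatedD[OF S, of a b a' b'] first l pos T' sym[of b a']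
      by simp
  next
    case second
    then have "cut_dist A a b = 1" "cut_dist A a' b' = 1" "cut_dist A a' b = 0"
      "cut_dist A a b' = 0" "cut_dist A a a' = 1" "cut_dist A b b' = 1"
      by (auto simp: cut_dist_def)
    then show ?thesis using isolatedD[OF S, of a b' a' b] second l pos T' sym[of b' a'] sym[of b' b]
      by simp
  next
    case level
    then have "l * cut_dist A a b + l * cut_dist A a' b' = l * cut_dist A a a' + l * cut_dist A b b'"
      "l * cut_dist A a' b + l * cut_dist A a b' = l * cut_dist A a a' + l * cut_dist A b b'"
      by (simp_all flip: distrib_left)
    then show ?thesis using T' by linarith
  qed
qed

subsection \<open>Subtracting splits\<close>

lemma pseudometricD:
  assumes "pseudometric d"
  shows "d x x = 0" "0 \<le> d x y" "d x y = d y x" "d x z \<le> d x y + d y z"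
  using assms by (auto simp: pseudometric_def)

lemma d_splitE:
  assumes "d_split d S" "pseudometric d"
  obtains A where "S = {A, - A}" "A \<noteq> {}" "- A \<noteq> {}" "split_dist S = cut_dist A"
    "isolated d A (isolation_index d S)" "0 < isolation_index d S"
proof -
  have pos: "0 < isolation_index d S" and "is_split S"
    using assms(1) by (auto simp: d_split_def)
  then obtain A where A: "S = {A, - A}" "A \<noteq> {}" "- A \<noteq> {}" "split_dist S = cut_dist A"
    by (elim is_splitE)
  moreover have "isolated d A (isolation_index d S)"
    using le_isolation_index_iff[where d = d, OF A(1-3) pseudometricD(3)[OF assms(2)] pos] by simp
  ultimately show ?thesis using that pos by blast
qed

text \<open>The infinite sum covers finite families and the family of all d-splits at once. Its
  default value 0 for divergent series does no harm, since \<open>split_subtract_all_has_sum\<close>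
  shows convergence for the latter.\<close>

definition split_subtract ::
  "('a \<Rightarrow> 'a \<Rightarrow> real) \<Rightarrow> ('a set set \<Rightarrow> real) \<Rightarrow> 'a set set set \<Rightarrow> 'a \<Rightarrow> 'a \<Rightarrow> real"
  where "split_subtract d l F x y = d x y - (\<Sum>\<^sub>\<infinity>S\<in>F. l S * split_dist S x y)"

lemma split_subtract_empty [simp]: "split_subtract d l {} = d"
  by (simp add: split_subtract_def fun_eq_iff)

lemma split_subtract_insert:
  assumes "finite F" "S \<notin> F" "split_dist S = cut_dist A"
  shows "split_subtract d l (insert S F) = (\<lambda>x y. split_subtract d l F x y - l S * cut_dist A x y)"
  using assms by (simp add: split_subtract_def fun_eq_iff)

text \<open>Both claims go through one induction: the next split may be subtracted because its
  isolation index with respect to the original \<open>d\<close> still bounds its isolation in the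
  remainder.\<close>

lemma split_subtract_finite:
  assumes d: "pseudometric d" and "finite F"
    and F: "\<And>S. S \<in> F \<Longrightarrow> d_split d S \<and> 0 \<le> l S \<and> l S \<le> isolation_index d S"
  shows "pseudometric (split_subtract d l F) \<and>
    (\<forall>T B. d_split d T \<and> T \<notin> F \<and> T = {B, - B} \<longrightarrow>
       isolated (split_subtract d l F) B (isolation_index d T))"
  using assms(2) F
proof (induction F)
  case empty
  have "isolated d B (isolation_index d T)" if T: "d_split d T" "T = {B, - B}" for T B
  proof -
    obtain A where A: "T = {A, - A}" "A \<noteq> {}" "- A \<noteq> {}" "split_dist T = cut_dist A"
      "isolated d A (isolation_index d T)" "0 < isolation_index d T"
      by (rule d_splitE[OF T(1) d])
    then have "B \<noteq> {}" "- B \<noteq> {}" using T(2) unfolding doubleton_eq_iff by blast+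
    then show ?thesis
      using le_isolation_index_iff[where d = d, OF T(2) _ _ pseudometricD(3)[OF d] A(6)] by simp
  qed
  then show ?case using d by simp
next
  case (insert S F)
  let ?d = "split_subtract d l F"
  have S: "d_split d S" "0 \<le> l S" "l S \<le> isolation_index d S" using insert.prems by auto
  obtain A where A: "S = {A, - A}" "split_dist S = cut_dist A" using d_splitE[OF S(1) d] by blast
  have IH: "pseudometric ?d"
    "\<And>T B. d_split d T \<Longrightarrow> T \<notin> F \<Longrightarrow> T = {B, - B} \<Longrightarrow> isolated ?d B (isolation_index d T)"
    using insert.IH insert.prems by blast+
  note eq = split_subtract_insert[OF insert.hyps A(2), of d l]
  have iso: "isolated ?d A (isolation_index d S)" using IH(2) S(1) insert.hyps(2) A(1) by blast
  have "isolated (split_subtract d l (insert S F)) B (isolation_index d T)"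
    if T: "d_split d T" "T \<notin> insert S F" "T = {B, - B}" for T B
  proof -
    have "S \<noteq> T" using T(2) by blast
    then have "A \<noteq> B" "A \<noteq> - B" using T(3) A(1) by (metis, metis double_complement insert_commute)
    moreover have "isolated ?d B (isolation_index d T)" using IH(2) T by blast
    moreover have "0 < isolation_index d T" using T(1) by (simp add: d_split_def)
    ultimately show ?thesis
      unfolding eq
      using isolated_subtract_cut[where d = ?d, OF pseudometricD(3)[OF IH(1)] iso _ _ _ S(2,3)] by blast
  qed
  moreover have "pseudometric (split_subtract d l (insert S F))"
    unfolding eq using pseudometric_subtract_cut[OF IH(1) iso S(2,3)] .
  ultimately show ?case by blast
qed

text \<open>One quadruple is followed through the subtraction: splits other than \<open>T\<close> do
  not raise its gap, while \<open>T\<close> lowers it by exactly \<open>2 * l T\<close>. This is the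
  source of split-primality of the remainder.\<close>

lemma gap_split_subtract:
  assumes d: "pseudometric d" and "finite F"
    and F: "\<And>S. S \<in> F \<Longrightarrow> d_split d S \<and> 0 \<le> l S \<and> l S \<le> isolation_index d S"
    and T: "T = {B, - B}" and pts: "a \<in> B" "a' \<in> B" "b \<notin> B" "b' \<notin> B"
  shows "gap (split_subtract d l F) a a' b b' \<le> gap d a a' b b' - (if T \<in> F then 2 * l T else 0)"
  using assms(2) F
proof (induction F)
  case empty
  then show ?case by simp
next
  case (insert S F)
  let ?d = "split_subtract d l F"
  have S: "d_split d S" "0 \<le> l S" "l S \<le> isolation_index d S" using insert.prems by auto
  obtain A where A: "S = {A, - A}" "split_dist S = cut_dist A" using d_splitE[OF S(1) d] by blast
  note eq = split_subtract_insert[OF insert.hyps(1,2), of _ d l]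
  have F': "pseudometric ?d" "\<And>B. S = {B, - B} \<Longrightarrow> isolated ?d B (isolation_index d S)"
    using split_subtract_finite[OF d insert.hyps(1), of l] insert.prems insert.hyps(2) S(1) by blast+
  have IH: "gap ?d a a' b b' \<le> gap d a a' b b' - (if T \<in> F then 2 * l T else 0)"
    using insert.IH insert.prems by blast
  show ?case
  proof (cases "S = T")
    case True
    then have "B = A \<or> B = - A" using A(1) T unfolding doubleton_eq_iff by blast
    then have "split_dist S = cut_dist B"
      using A(2) by (auto simp: cut_dist_def fun_eq_iff)
    note eq' = split_subtract_insert[OF insert.hyps(1,2) this, of d l]
    show ?thesis
      unfolding eq' using gap_subtract_own_cut[OF F'(2) S(2,3) pts] T True IH insert.hyps(2)
      by simp
  next
    case False
    then show ?thesis
      using gap_subtract_cut[where d = ?d, OF F'(2)[OF A(1)] S(2,3) pseudometricD(3)[OF F'(1)], of a a' b b']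
        IH unfolding eq[OF A(2)] by simp
  qed
qed

section \<open>Integer-valued metrics: attained indices and finitely many separating splits\<close>

lemma gap_Ints: "(\<And>x y. d x y \<in> \<int>) \<Longrightarrow> gap d a a' b b' \<in> \<int>"
  unfolding gap_def max_def by auto

text \<open>The gaps are integers bounded below, and a set of integers is closed, so it contains its
  infimum.\<close>

lemma isolation_index_attained:
  assumes S: "S = {A, - A}" "A \<noteq> {}" "- A \<noteq> {}" and sym: "\<And>x y. d x y = d y x"
    and int: "\<And>x y. d x y \<in> \<int>"
  obtains a a' b b' where "a \<in> A" "a' \<in> A" "b \<notin> A" "b' \<notin> A" "2 * isolation_index d S = gap d a a' b b'"
proof -
  have "gaps d A \<subseteq> \<int>" using gap_Ints[where d = d, OF int] unfolding gaps_def by blast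
  then have "Inf (gaps d A) \<in> gaps d A"
    by (intro closed_contains_Inf gaps_nonempty S bdd_below_gaps closed_subset_Ints)
  then show ?thesis
    using that isolation_index_eq[where d = d, OF S(1) sym] unfolding gaps_def by auto
qed

lemma isolation_index_ge_half:
  assumes d: "pseudometric d" and int: "\<And>x y. d x y \<in> \<int>" and S: "d_split d S"
  shows "1/2 \<le> isolation_index d S"
proof -
  obtain A where A: "S = {A, - A}" "A \<noteq> {}" "- A \<noteq> {}" "split_dist S = cut_dist A"
    "isolated d A (isolation_index d S)" "0 < isolation_index d S"
    by (rule d_splitE[OF S d])
  obtain a a' b b' where g: "2 * isolation_index d S = gap d a a' b b'"
    by (rule isolation_index_attained[where d = d, OF A(1-3) pseudometricD(3)[OF d] int])
  moreover have "gap d a a' b b' \<in> \<int>" by (rule gap_Ints[where d = d, OF int])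
  then obtain n :: int where "gap d a a' b b' = of_int n" by (elim Ints_cases)
  ultimately show ?thesis using A(6) by (cases "1 \<le> n") auto
qed

text \<open>Subtracting a finite family with full coefficients leaves non-negative distances. Each
  member separating \<open>x\<close> and \<open>y\<close> uses up at least \<open>1/2\<close> of
  \<open>d x y\<close>, which bounds the size of the family.\<close>

lemma finite_separating_splits:
  assumes d: "pseudometric d" and int: "\<And>x y. d x y \<in> \<int>"
  shows "finite {S. d_split d S \<and> split_dist S x y \<noteq> 0}"
proof -
  have "card G \<le> nat \<lceil>2 * d x y\<rceil>" if G: "G \<subseteq> {S. d_split d S \<and> split_dist S x y \<noteq> 0}" "finite G" for G
  proof -
    have "pseudometric (split_subtract d (isolation_index d) G)"
      using split_subtract_finite[OF d G(2), of "isolation_index d"] G(1)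
      by (metis (no_types, lifting) d_split_def less_imp_le mem_Collect_eq order_refl subset_eq)
    then have "(\<Sum>S\<in>G. isolation_index d S * split_dist S x y) \<le> d x y"
      using pseudometricD(2)[of "split_subtract d (isolation_index d) G" x y] G(2)
      by (simp add: split_subtract_def)
    moreover have "(\<Sum>S\<in>G. 1/2) \<le> (\<Sum>S\<in>G. isolation_index d S * split_dist S x y)"
    proof (intro sum_mono)
      fix S assume "S \<in> G"
      then have "d_split d S" "split_dist S x y = 1"
        using G(1) by (auto simp: split_dist_def split: if_splits)
      then show "1/2 \<le> isolation_index d S * split_dist S x y"
        using isolation_index_ge_half[OF d int] by simp
    qed
    ultimately have "real (card G) \<le> 2 * d x y" by simp
    then show ?thesis by linarith
  qed
  then show ?thesis using finite_if_finite_subsets_card_bdd by blast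
qed

section \<open>Subtraction of all d-splits at once\<close>

context
  fixes d :: "'a \<Rightarrow> 'a \<Rightarrow> real" and l :: "'a set set \<Rightarrow> real"
  assumes d: "pseudometric d" and int: "\<And>x y. d x y \<in> \<int>"
    and l: "\<And>S. d_split d S \<Longrightarrow> 0 \<le> l S \<and> l S \<le> isolation_index d S"
begin

lemma has_sum_separating:
  assumes "finite F" "F \<subseteq> Collect (d_split d)" "{S. d_split d S \<and> split_dist S x y \<noteq> 0} \<subseteq> F"
  shows "((\<lambda>S. l S * split_dist S x y) has_sum (\<Sum>S\<in>F. l S * split_dist S x y)) (Collect (d_split d))"
  by (rule has_sum_finite_neutralI) (use assms in auto)

lemma split_subtract_all_has_sum:
  "((\<lambda>S. l S * split_dist S x y) has_sum (d x y - split_subtract d l (Collect (d_split d)) x y))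
     (Collect (d_split d))"
proof -
  have "((\<lambda>S. l S * split_dist S x y) has_sum
      (\<Sum>S\<in>{S. d_split d S \<and> split_dist S x y \<noteq> 0}. l S * split_dist S x y)) (Collect (d_split d))"
    by (rule has_sum_separating) (use finite_separating_splits[OF d int] in auto)
  then show ?thesis
    unfolding split_subtract_def using has_sum_infsum[OF has_sum_imp_summable] by simp
qed

text \<open>Reduces any claim about finitely many points to a finite subtraction. The family
  \<open>G\<close> allows a given split to be kept in \<open>F\<close> even if it separates no two
  points of \<open>Y\<close>.\<close>

lemma split_subtract_all_locally_finite:
  assumes "finite Y" "finite G" "G \<subseteq> Collect (d_split d)"
  obtains F where "finite F" "G \<subseteq> F" "F \<subseteq> Collect (d_split d)"
    "\<And>x y. x \<in> Y \<Longrightarrow> y \<in> Y \<Longrightarrow> split_subtract d l (Collect (d_split d)) x y = split_subtract d l F x y"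
proof
  let ?F = "G \<union> (\<Union>x\<in>Y. \<Union>y\<in>Y. {S. d_split d S \<and> split_dist S x y \<noteq> 0})"
  show fin: "finite ?F" and sub: "?F \<subseteq> Collect (d_split d)"
    using assms finite_separating_splits[OF d int] by auto
  show "split_subtract d l (Collect (d_split d)) x y = split_subtract d l ?F x y"
    if "x \<in> Y" "y \<in> Y" for x y
    unfolding split_subtract_def using infsumI[OF has_sum_separating[OF fin sub, of x y]] fin that
    by auto
qed auto

lemma pseudometric_split_subtract_all:
  "pseudometric (split_subtract d l (Collect (d_split d)))" (is "pseudometric ?d")
proof -
  have *: "?d x x = 0 \<and> 0 \<le> ?d x y \<and> ?d x y = ?d y x \<and> ?d x z \<le> ?d x y + ?d y z" for x y z
  proof -
    obtain F where F: "finite F" "F \<subseteq> Collect (d_split d)"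
      "\<And>u v. u \<in> {x, y, z} \<Longrightarrow> v \<in> {x, y, z} \<Longrightarrow> ?d u v = split_subtract d l F u v"
      using split_subtract_all_locally_finite[of "{x, y, z}" "{}"] by auto
    have pm: "pseudometric (split_subtract d l F)"
      using split_subtract_finite[OF d F(1), of l] F(2) l by blast
    have "?d u v = split_subtract d l F u v" if "u \<in> {x, y, z}" "v \<in> {x, y, z}" for u v
      using F(3) that .
    then show ?thesis
      using pseudometricD(1,2)[OF pm, of x] pseudometricD(3)[OF pm, of x y]
        pseudometricD(4)[OF pm, of x z y] by (metis insertCI)
  qed
  then show ?thesis unfolding pseudometric_def by blast
qed

lemma split_prime_split_subtract_all:
  assumes "l = isolation_index d"
  shows "split_prime (split_subtract d l (Collect (d_split d)))" (is "split_prime ?d")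
proof -
  have "isolation_index ?d T = 0" if T: "is_split T" for T
  proof -
    obtain B where B: "T = {B, - B}" "B \<noteq> {}" "- B \<noteq> {}"
      using T by (elim is_splitE)
    \<comment> \<open>At a quadruple attaining the index of \<open>T\<close>, the gap is used up
      completely: it is 0 from the start if \<open>T\<close> is no d-split, and otherwise
      subtracting \<open>T\<close> with full coefficient removes all of it.\<close>
    obtain a a' b b' where pts: "a \<in> B" "a' \<in> B" "b \<notin> B" "b' \<notin> B"
      and g: "2 * isolation_index d T = gap d a a' b b'"
      using isolation_index_attained[where d = d, OF B pseudometricD(3)[OF d] int] by blast
    obtain F where F: "finite F" "{T} \<inter> Collect (d_split d) \<subseteq> F" "F \<subseteq> Collect (d_split d)"
      "\<And>x y. x \<in> {a, a', b, b'} \<Longrightarrow> y \<in> {a, a', b, b'} \<Longrightarrow> ?d x y = split_subtract d l F x y"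
      using split_subtract_all_locally_finite[of "{a, a', b, b'}" "{T} \<inter> Collect (d_split d)"] by auto
    have "gap ?d a a' b b' = gap (split_subtract d l F) a a' b b'"
      unfolding gap_def using F(4) by simp
    also have "\<dots> \<le> gap d a a' b b' - (if T \<in> F then 2 * l T else 0)"
      using gap_split_subtract[OF d F(1) _ B(1) pts, of l] F(3) l by blast
    also have "\<dots> \<le> 0"
    proof (cases "T \<in> F")
      case False
      then have "\<not> d_split d T" using F(2) by blast
      then have "isolation_index d T \<le> 0" using T by (simp add: d_split_def)
      then show ?thesis using g False by simp
    qed (use g assms in simp)
    finally have "gap ?d a a' b b' \<le> 0" .
    moreover have "gap ?d a a' b b' \<in> gaps ?d B" using pts unfolding gaps_def by blast
    then have "Inf (gaps ?d B) \<le> gap ?d a a' b b'"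
      by (intro cInf_lower bdd_below_gaps)
    moreover note sym = pseudometricD(3)[OF pseudometric_split_subtract_all]
    ultimately have "isolation_index ?d T \<le> 0"
      using isolation_index_eq[where d = ?d, OF B(1) sym] by simp
    then show ?thesis using isolation_index_nonneg[where d = ?d, OF T sym] by simp
  qed
  then show ?thesis using pseudometric_split_subtract_all by (simp add: split_prime_def)
qed

end

subsection \<open>Decomposing the injective hull\<close>

lemma inj_hull_iff:
  "f \<in> inj_hull d \<longleftrightarrow> f \<in> Delta d \<and> (\<forall>x e. 0 < e \<longrightarrow> (\<exists>y. f x + f y < d x y + e))"
proof
  assume "f \<in> inj_hull d"
  then have f: "ereal (f x) = (SUP y. ereal (d x y - f y))" for x
    by (simp add: inj_hull_def)
  have "d x y \<le> f x + f y" for x y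
  proof -
    have "ereal (d x y - f y) \<le> ereal (f x)"
      unfolding f[of x] by (rule SUP_upper) simp
    then show ?thesis by simp
  qed
  moreover have "\<exists>y. f x + f y < d x y + e" if "0 < e" for x e
  proof -
    have "ereal (f x - e) < (SUP y. ereal (d x y - f y))"
      unfolding f[of x, symmetric] using that by simp
    then obtain y where "ereal (f x - e) < ereal (d x y - f y)"
      unfolding less_SUP_iff by blast
    then show ?thesis by (intro exI[of _ y]) simp
  qed
  ultimately show "f \<in> Delta d \<and> (\<forall>x e. 0 < e \<longrightarrow> (\<exists>y. f x + f y < d x y + e))"
    by (simp add: Delta_def)
next
  assume f: "f \<in> Delta d \<and> (\<forall>x e. 0 < e \<longrightarrow> (\<exists>y. f x + f y < d x y + e))"
  have "ereal (f x) = (SUP y. ereal (d x y - f y))" for x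
  proof (rule antisym)
    show "ereal (f x) \<le> (SUP y. ereal (d x y - f y))"
    proof (rule ereal_le_epsilon2)
      fix e :: real assume "0 < e"
      then obtain y where "f x + f y < d x y + e" using f by blast
      then have "ereal (f x) \<le> ereal (d x y - f y) + ereal e" by simp
      also have "\<dots> \<le> (SUP y. ereal (d x y - f y)) + ereal e"
        by (intro add_right_mono SUP_upper) simp
      finally show "ereal (f x) \<le> (SUP y. ereal (d x y - f y)) + ereal e" .
    qed
    show "(SUP y. ereal (d x y - f y)) \<le> ereal (f x)"
    proof (rule SUP_least)
      fix y
      have "d x y \<le> f x + f y" using f by (simp add: Delta_def)
      then show "ereal (d x y - f y) \<le> ereal (f x)" by simp
    qed
  qed
  then show "f \<in> inj_hull d" by (simp add: inj_hull_def)
qed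

text \<open>For \<open>t\<close> in [0,1] these are the points of the segment E(X, \<delta>) of a
  cut, parametrised by the value on the side \<open>A\<close>.\<close>

definition side_fun :: "'a set \<Rightarrow> real \<Rightarrow> 'a \<Rightarrow> real" where
  "side_fun A t x = (if x \<in> A then t else 1 - t)"

lemma cut_dist_le_side_fun:
  "t \<in> {0..1} \<Longrightarrow> cut_dist A x y \<le> side_fun A t x + side_fun A t y"
  by (auto simp: side_fun_def cut_dist_def)

lemma side_fun_nonneg: "t \<in> {0..1} \<Longrightarrow> 0 \<le> side_fun A t x"
  by (auto simp: side_fun_def)

lemma side_fun_in_inj_hull:
  assumes "A \<noteq> {}" "- A \<noteq> {}" "t \<in> {0..1}"
  shows "side_fun A t \<in> inj_hull (cut_dist A)"
  unfolding inj_hull_iff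
proof (intro conjI allI impI)
  show "side_fun A t \<in> Delta (cut_dist A)"
    unfolding Delta_def using cut_dist_le_side_fun[OF assms(3), of A] by blast
  fix x and e :: real assume "0 < e"
  obtain y where "x \<in> A \<longleftrightarrow> y \<notin> A" using assms(1,2) by blast
  with \<open>0 < e\<close> show "\<exists>y. side_fun A t x + side_fun A t y < cut_dist A x y + e"
    by (intro exI[of _ y]) (auto simp: side_fun_def cut_dist_def)
qed

text \<open>Pairs inside \<open>A\<close> bound \<open>t\<close> from above, pairs outside
  \<open>A\<close> bound \<open>1 - t\<close> from above, and mixed pairs impose nothing, as both
  sides of their inequality drop by \<open>l\<close>. Isolation makes the two kinds of bounds
  compatible.\<close>

lemma Delta_subtract_cut:
  assumes f: "f \<in> Delta d" and iso: "isolated d A c" and l: "0 \<le> l" "l \<le> c" and ne: "A \<noteq> {}"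
  obtains t where "t \<in> {0..1}"
    "(\<lambda>x. f x - l * side_fun A t x) \<in> Delta (\<lambda>x y. d x y - l * cut_dist A x y)"
proof (cases "l = 0")
  case True
  then show ?thesis using that[of 0] f by simp
next
  case False
  then have l0: "0 < l" using l by simp
  have f': "d x y \<le> f x + f y" for x y using f by (simp add: Delta_def)
  let ?V = "{(f a + f a' - d a a') / (2 * l) | a a'. a \<in> A \<and> a' \<in> A}"
  have V0: "0 \<le> v" if "v \<in> ?V" for v
    using that f' l0 by (auto intro!: divide_nonneg_pos)
  have bdd: "bdd_below ?V" using V0 by (rule bdd_belowI)
  have Vne: "?V \<noteq> {}" using ne by blast
  \<comment> \<open>The largest value in [0,1] that the pairs inside \<open>A\<close> allow, hence
    the best choice for the pairs outside.\<close>
  define t where "t = min 1 (Inf ?V)"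
  have t: "t \<in> {0..1}" unfolding t_def using cInf_greatest[OF Vne V0] by simp
  have P: "d a a' \<le> (f a - l * t) + (f a' - l * t)" if "a \<in> A" "a' \<in> A" for a a'
  proof -
    have "(f a + f a' - d a a') / (2 * l) \<in> ?V" using that by blast
    then have "t \<le> (f a + f a' - d a a') / (2 * l)"
      unfolding t_def using cInf_lower[OF _ bdd] by (simp add: min.coboundedI2)
    then show ?thesis using l0 by (simp add: pos_le_divide_eq algebra_simps)
  qed
  have Q: "d b b' \<le> (f b - l * (1 - t)) + (f b' - l * (1 - t))" if b: "b \<notin> A" "b' \<notin> A" for b b'
  proof (cases "t = 1")
    case True
    then show ?thesis using f' by simp
  next
    case False
    have "1 - (f b + f b' - d b b') / (2 * l) \<le> Inf ?V"
    proof (rule cInf_greatest[OF Vne])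
      fix v assume "v \<in> ?V"
      then obtain a a' where v: "v = (f a + f a' - d a a') / (2 * l)" "a \<in> A" "a' \<in> A" by blast
      have "2 * c + d a a' + d b b' \<le> max (d a b + d a' b') (d a' b + d a b')"
        using isolatedD[OF iso, of a a' b b'] v b by blast
      \<comment> \<open>Each of the two crossing sums is at most
        \<open>f a + f a' + f b + f b'\<close>, so the maximum in the isolation inequality is
        too.\<close>
      then have "2 * l \<le> (f a + f a' - d a a') + (f b + f b' - d b b')"
        using f'[of a b] f'[of a' b'] f'[of a' b] f'[of a b'] l by linarith
      then have "2 * l / (2 * l) \<le> ((f a + f a' - d a a') + (f b + f b' - d b b')) / (2 * l)"
        using l0 by (intro divide_right_mono) auto
      then show "1 - (f b + f b' - d b b') / (2 * l) \<le> v"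
        using l0 unfolding v by (simp add: add_divide_distrib)
    qed
    then have "1 - t \<le> (f b + f b' - d b b') / (2 * l)"
      using False unfolding t_def by (simp add: min_def split: if_splits)
    then have "(1 - t) * (2 * l) \<le> f b + f b' - d b b'"
      using l0 by (subst (asm) pos_le_divide_eq) auto
    then show ?thesis by (simp add: algebra_simps)
  qed
  have "d x y - l * cut_dist A x y \<le> (f x - l * side_fun A t x) + (f y - l * side_fun A t y)" for x y
    using P[of x y] Q[of x y] f'[of x y]
    by (cases "x \<in> A"; cases "y \<in> A") (auto simp: side_fun_def cut_dist_def algebra_simps)
  then show ?thesis using that[OF t] by (simp add: Delta_def)
qed

text \<open>One fixed side per split, so that a choice of hull elements for a whole family of splits
  becomes a function \<open>t\<close> into [0,1].\<close>

definition part :: "'a set set \<Rightarrow> 'a set" where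
  "part S = (SOME A. A \<in> S)"

lemma part_split:
  assumes "is_split S"
  shows "S = {part S, - part S}" "part S \<noteq> {}" "- part S \<noteq> {}" "split_dist S = cut_dist (part S)"
proof -
  obtain A where A: "S = {A, - A}" "A \<noteq> {}" "- A \<noteq> {}" "split_dist S = cut_dist A"
    by (rule is_splitE[OF assms])
  have "part S \<in> S" unfolding part_def by (rule someI[of _ A]) (simp add: A)
  then consider "part S = A" | "part S = - A" using A(1) by blast
  then show "S = {part S, - part S}" "part S \<noteq> {}" "- part S \<noteq> {}" "split_dist S = cut_dist (part S)"
    using A by (cases; auto simp: cut_dist_def fun_eq_iff)+
qed

lemma Delta_split_subtract_finite:
  assumes d: "pseudometric d" and f: "f \<in> Delta d" and "finite F"
    and F: "\<And>S. S \<in> F \<Longrightarrow> d_split d S \<and> 0 \<le> l S \<and> l S \<le> isolation_index d S"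
  shows "\<exists>t. (\<forall>S. t S \<in> {0..1}) \<and>
    (\<lambda>x. f x - (\<Sum>S\<in>F. l S * side_fun (part S) (t S) x)) \<in> Delta (split_subtract d l F)"
  using assms(3) F
proof (induction F)
  case empty
  show ?case using f by (intro exI[of _ "\<lambda>_. 0"]) simp
next
  case (insert S F)
  let ?d = "split_subtract d l F"
  have S: "d_split d S" "0 \<le> l S" "l S \<le> isolation_index d S" using insert.prems by auto
  have split: "is_split S" using S(1) by (simp add: d_split_def)
  have iso: "isolated ?d (part S) (isolation_index d S)"
    using split_subtract_finite[OF d insert.hyps(1), of l] insert.prems insert.hyps(2) S(1)
      part_split(1)[OF split] by blast
  obtain t where t: "\<forall>S. t S \<in> {0..1}"
    "(\<lambda>x. f x - (\<Sum>S\<in>F. l S * side_fun (part S) (t S) x)) \<in> Delta ?d"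
    using insert.IH insert.prems by blast
  obtain s where s: "s \<in> {0..1}"
    "(\<lambda>x. f x - (\<Sum>S\<in>F. l S * side_fun (part S) (t S) x) - l S * side_fun (part S) s x)
       \<in> Delta (\<lambda>x y. ?d x y - l S * cut_dist (part S) x y)"
    by (rule Delta_subtract_cut[OF t(2) iso S(2,3) part_split(2)[OF split]])
  have "(\<Sum>S'\<in>insert S F. l S' * side_fun (part S') ((t(S := s)) S') x)
      = (\<Sum>S\<in>F. l S * side_fun (part S) (t S) x) + l S * side_fun (part S) s x" for x
  proof -
    have "(\<Sum>S'\<in>F. l S' * side_fun (part S') ((t(S := s)) S') x)
        = (\<Sum>S\<in>F. l S * side_fun (part S) (t S) x)"
      using insert.hyps(2) by (intro sum.cong) auto
    then show ?thesis using insert.hyps by simp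
  qed
  then show ?case
    using s t(1) unfolding split_subtract_insert[OF insert.hyps part_split(4)[OF split]]
    by (intro exI[of _ "t(S := s)"]) (simp add: algebra_simps)
qed

text \<open>The parameters found for a finite family depend on that family. Each inequality involves
  finitely many coordinates of \<open>t\<close>, so it defines a closed set, and the product of
  copies of [0,1] is compact. Finitely many inequalities are met together by the parameters for the
  union of their families, because all summands are non-negative and enlarging \<open>F\<close> only
  strengthens the inequality.\<close>

lemma Delta_split_subtract_compactness:
  assumes d: "pseudometric d" and f: "f \<in> Delta d"
    and l: "\<And>S. d_split d S \<Longrightarrow> 0 \<le> l S \<and> l S \<le> isolation_index d S"
  obtains t where "\<And>S. t S \<in> {0..1}"
    "\<And>F x y. finite F \<Longrightarrow> F \<subseteq> Collect (d_split d) \<Longrightarrow>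
       (\<Sum>S\<in>F. l S * (side_fun (part S) (t S) x + side_fun (part S) (t S) y - split_dist S x y))
         \<le> f x + f y - d x y"
proof -
  define K :: "('a set set \<Rightarrow> real) set" where "K = (\<Pi>\<^sub>E S\<in>UNIV. {0..1})"
  define g where "g t F x y =
    (\<Sum>S\<in>F. l S * (side_fun (part S) (t S) x + side_fun (part S) (t S) y - split_dist S x y))"
    for t F x y
  define I :: "('a set set set \<times> 'a \<times> 'a) set"
    where "I = {(F, x, y). finite F \<and> F \<subseteq> Collect (d_split d)}"
  let ?C = "\<lambda>(F, x, y). {t. g t F x y \<le> f x + f y - d x y}"
  have "compactin (product_topology (\<lambda>S. euclidean) UNIV) K"
    unfolding K_def compactin_PiE by simp
  then have comp: "compact K"
    by (metis compactin_euclidean_iff euclidean_product_topology)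
  have closed: "closed (?C i)" for i
  proof (cases i)
    case (fields F x y)
    have "continuous_on UNIV (\<lambda>t. side_fun (part S) (t S) z)" for S z
      unfolding side_fun_def
      by (cases "z \<in> part S") (auto intro!: continuous_intros continuous_on_product_coordinates)
    then show ?thesis
      unfolding fields g_def by (auto intro!: closed_Collect_le continuous_intros)
  qed
  have fip: "K \<inter> (\<Inter>i\<in>I'. ?C i) \<noteq> {}" if I': "finite I'" "I' \<subseteq> I" for I'
  proof -
    define F where "F = (\<Union>i\<in>I'. fst i)"
    have F: "finite F" "F \<subseteq> Collect (d_split d)"
      using I' unfolding F_def I_def by fastforce+
    obtain t where t: "\<forall>S. t S \<in> {0..1}"
      "(\<lambda>x. f x - (\<Sum>S\<in>F. l S * side_fun (part S) (t S) x)) \<in> Delta (split_subtract d l F)"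
      using Delta_split_subtract_finite[OF d f F(1), of l] F(2) l by blast
    have le: "g t F x y \<le> f x + f y - d x y" for x y
    proof -
      have "split_subtract d l F x y \<le> f x - (\<Sum>S\<in>F. l S * side_fun (part S) (t S) x)
          + (f y - (\<Sum>S\<in>F. l S * side_fun (part S) (t S) y))"
        using t(2) by (simp add: Delta_def)
      then show ?thesis
        using F(1) by (simp add: g_def split_subtract_def sum.distrib sum_subtractf algebra_simps)
    qed
    have mono: "g t G x y \<le> g t F x y" if "G \<subseteq> F" for G x y
      unfolding g_def
    proof (rule sum_mono2[OF F(1) that])
      fix S assume "S \<in> F - G"
      then have S: "d_split d S" using F(2) by blast
      then have "split_dist S = cut_dist (part S)" by (intro part_split) (simp add: d_split_def)
      then show "0 \<le> l S * (side_fun (part S) (t S) x + side_fun (part S) (t S) y - split_dist S x y)"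
        using l[OF S] cut_dist_le_side_fun[of "t S" "part S" x y] t(1) by simp
    qed
    have "t \<in> ?C i" if "i \<in> I'" for i
    proof (cases i)
      case (fields G x y)
      then have "G \<subseteq> F" using that unfolding F_def by force
      then show ?thesis using mono[of G x y] le[of x y] by (simp add: fields)
    qed
    moreover have "t \<in> K" using t(1) by (simp add: K_def PiE_UNIV_domain)
    ultimately show ?thesis by blast
  qed
  have "K \<inter> (\<Inter>i\<in>I. ?C i) \<noteq> {}"
    by (rule compact_imp_fip_image[OF comp closed fip])
  then obtain t where t: "t \<in> K" "\<And>i. i \<in> I \<Longrightarrow> t \<in> ?C i" by blast
  show ?thesis
  proof (rule that)
    show "t S \<in> {0..1}" for S using t(1) by (auto simp: K_def)
    show "(\<Sum>S\<in>F. l S * (side_fun (part S) (t S) x + side_fun (part S) (t S) y - split_dist S x y))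
        \<le> f x + f y - d x y" if "finite F" "F \<subseteq> Collect (d_split d)" for F x y
      using t(2)[of "(F, x, y)"] that by (simp add: I_def g_def)
  qed
qed

section \<open>The decomposition over all d-splits\<close>

lemma ennreal_infsum:
  fixes f :: "'b \<Rightarrow> real"
  assumes "f summable_on A" "\<And>x. x \<in> A \<Longrightarrow> 0 \<le> f x"
  shows "(\<Sum>\<^sub>\<infinity>x\<in>A. ennreal (f x)) = ennreal (infsum f A)"
proof -
  have "(\<Sum>\<^sub>\<infinity>x\<in>A. ennreal (f x)) = (SUP F\<in>{F. finite F \<and> F \<subseteq> A}. \<Sum>x\<in>F. ennreal (f x))"
    by (intro nonneg_infsum_complete) simp
  also have "\<dots> = (SUP F\<in>{F. finite F \<and> F \<subseteq> A}. ennreal (sum f F))"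
    using assms(2) by (intro SUP_cong refl sum_ennreal) auto
  also have "\<dots> = ennreal (infsum f A)"
    using infsum_nonneg_is_SUPREMUM_ennreal[OF assms] by simp
  finally show ?thesis .
qed

lemma inj_hull_subset_hull_sum:
  assumes d: "pseudometric d" and int: "\<And>x y. d x y \<in> \<int>"
    and l: "\<And>S. d_split d S \<Longrightarrow> 0 \<le> l S \<and> l S \<le> isolation_index d S"
    and f: "f \<in> inj_hull d"
  shows "f \<in> real_functions_in
    (hull_sum (split_subtract d l (Collect (d_split d))) (Collect (d_split d)) l)"
proof -
  let ?\<S> = "Collect (d_split d)"
  let ?d1 = "split_subtract d l ?\<S>"
  have fD: "f \<in> Delta d" using f by (simp add: inj_hull_iff)
  obtain t where t: "\<And>S. t S \<in> {0..1}"
    and le: "\<And>F x y. finite F \<Longrightarrow> F \<subseteq> ?\<S> \<Longrightarrow>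
       (\<Sum>S\<in>F. l S * (side_fun (part S) (t S) x + side_fun (part S) (t S) y - split_dist S x y))
         \<le> f x + f y - d x y"
    using Delta_split_subtract_compactness[OF d fD l] by blast
  define h where "h S = side_fun (part S) (t S)" for S
  note le = le[folded h_def]
  have part: "part S \<noteq> {}" "- part S \<noteq> {}" "split_dist S = cut_dist (part S)" if "d_split d S" for S
    using part_split[of S] that by (auto simp: d_split_def)
  have h: "h S \<in> inj_hull (split_dist S)" if "d_split d S" for S
    unfolding h_def part(3)[OF that] using part[OF that] t by (intro side_fun_in_inj_hull)
  have h0: "0 \<le> h S x" for S x unfolding h_def by (rule side_fun_nonneg[OF t])
  have lh0: "0 \<le> l S * h S x" if "S \<in> ?\<S>" for S x using that l h0 by simp
  \<comment> \<open>On the diagonal the distances vanish, so the inequality for the pair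
    \<open>x, x\<close> bounds the partial sums and gives convergence.\<close>
  have "(\<Sum>S\<in>F. l S * h S x) \<le> f x" if "finite F" "F \<subseteq> ?\<S>" for F x
  proof -
    have "(\<Sum>S\<in>F. l S * (h S x + h S x - split_dist S x x)) = (\<Sum>S\<in>F. 2 * (l S * h S x))"
      using that(2) part(3) by (intro sum.cong) (auto simp: cut_dist_def)
    also have "\<dots> = 2 * (\<Sum>S\<in>F. l S * h S x)" by (rule sum_distrib_left[symmetric])
    finally show ?thesis using le[OF that, of x x] pseudometricD(1)[OF d, of x] by simp
  qed
  then have sumh: "(\<lambda>S. l S * h S x) summable_on ?\<S>" for x
    using lh0 by (intro nonneg_bdd_above_summable_on bdd_aboveI[of _ "f x"]) auto
  have sumd: "(\<lambda>S. l S * split_dist S x y) summable_on ?\<S>" for x y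
    using split_subtract_all_has_sum[OF d int l] has_sum_imp_summable by blast
  define f1 where "f1 x = f x - (\<Sum>\<^sub>\<infinity>S\<in>?\<S>. l S * h S x)" for x
  have hs: "((\<lambda>S. l S * (h S x + h S y - split_dist S x y)) has_sum
      (\<Sum>\<^sub>\<infinity>S\<in>?\<S>. l S * h S x) + (\<Sum>\<^sub>\<infinity>S\<in>?\<S>. l S * h S y)
        + - (\<Sum>\<^sub>\<infinity>S\<in>?\<S>. l S * split_dist S x y)) ?\<S>" for x y
    using has_sum_add[OF has_sum_add[OF has_sum_infsum[OF sumh[of x]] has_sum_infsum[OF sumh[of y]]]
        has_sum_uminusI[OF has_sum_infsum[OF sumd[of x y]]]]
    by (simp add: algebra_simps)
  note sum = has_sum_imp_summable[OF hs]
  \<comment> \<open>The slack of \<open>f1\<close> is the slack of \<open>f\<close> minus the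
    series: finite partial sums show that it is non-negative, and non-negative summands show that it
    is no larger than the slack of \<open>f\<close>.\<close>
  have eq: "f1 x + f1 y - ?d1 x y
      = f x + f y - d x y - (\<Sum>\<^sub>\<infinity>S\<in>?\<S>. l S * (h S x + h S y - split_dist S x y))" for x y
    using infsumI[OF hs[of x y]] by (simp add: f1_def split_subtract_def)
  have "f1 \<in> inj_hull ?d1"
    unfolding inj_hull_iff
  proof (intro conjI allI impI)
    have "?d1 x y \<le> f1 x + f1 y" for x y
      using eq[of x y] infsum_le_finite_sums[OF sum le, of x y] by simp
    then show "f1 \<in> Delta ?d1" by (simp add: Delta_def)
  next
    fix x and e :: real assume "0 < e"
    then obtain y where y: "f x + f y < d x y + e" using f by (auto simp: inj_hull_iff)
    have "0 \<le> l S * (h S x + h S y - split_dist S x y)" if "S \<in> ?\<S>" for S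
      using l[of S] part(3)[of S] that cut_dist_le_side_fun[OF t, of "part S" x y S]
      by (simp add: h_def)
    then have "0 \<le> (\<Sum>\<^sub>\<infinity>S\<in>?\<S>. l S * (h S x + h S y - split_dist S x y))"
      by (rule infsum_nonneg)
    then have "f1 x + f1 y < ?d1 x y + e" using eq[of x y] y by simp
    then show "\<exists>y. f1 x + f1 y < ?d1 x y + e" by blast
  qed
  moreover have "ennreal (f x) = ennreal (f1 x) + (\<Sum>\<^sub>\<infinity>S\<in>?\<S>. ennreal (l S) * ennreal (h S x))" for x
  proof -
    have "(\<Sum>\<^sub>\<infinity>S\<in>?\<S>. ennreal (l S) * ennreal (h S x)) = (\<Sum>\<^sub>\<infinity>S\<in>?\<S>. ennreal (l S * h S x))"
      using l h0 by (intro infsum_cong) (simp add: ennreal_mult)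
    also have "\<dots> = ennreal (\<Sum>\<^sub>\<infinity>S\<in>?\<S>. l S * h S x)"
      by (rule ennreal_infsum[OF sumh lh0])
    \<comment> \<open>Needed because \<open>ennreal\<close> would turn a negative remainder into
      0.\<close>
    moreover have "0 \<le> f1 x"
    proof -
      have "?d1 x x \<le> f1 x + f1 x" using \<open>f1 \<in> inj_hull ?d1\<close> unfolding inj_hull_iff Delta_def by blast
      then show ?thesis
        using pseudometricD(1)[OF pseudometric_split_subtract_all[OF d int l], of x] by simp
    qed
    moreover have "0 \<le> (\<Sum>\<^sub>\<infinity>S\<in>?\<S>. l S * h S x)" by (rule infsum_nonneg[OF lh0])
    ultimately show ?thesis by (simp add: f1_def flip: ennreal_plus)
  qed
  moreover have "0 \<le> f x" for x
  proof -
    have "d x x \<le> f x + f x" using fD unfolding Delta_def by blast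
    then show ?thesis using pseudometricD(1)[OF d, of x] by simp
  qed
  ultimately show ?thesis
    unfolding real_functions_in_def hull_sum_def using h by blast
qed

subsection \<open>Functions in the hull tight on prescribed pairs\<close>

lemma Delta_minimal_in_inj_hull:
  assumes sym: "\<And>x y. d x y = d y x" and refl: "\<And>x. d x x = 0"
    and g: "g \<in> Delta d" and min: "\<And>h. h \<in> Delta d \<Longrightarrow> (\<And>x. h x \<le> g x) \<Longrightarrow> h = g"
  shows "g \<in> inj_hull d"
  unfolding inj_hull_iff
proof (intro conjI allI impI g)
  fix x and e :: real assume e: "0 < e"
  show "\<exists>y. g x + g y < d x y + e"
  proof (rule ccontr)
    assume "\<not> ?thesis"
    then have *: "d x y + e \<le> g x + g y" for y by (simp add: not_less)
    \<comment> \<open>Lowering by \<open>e / 2\<close> rather than \<open>e\<close>, since the pair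
      \<open>x, x\<close> loses the amount twice.\<close>
    let ?h = "g(x := g x - e / 2)"
    have "d u v \<le> ?h u + ?h v" for u v
    proof -
      have "d u v \<le> g u + g v" using g by (simp add: Delta_def)
      then show ?thesis using *[of u] *[of v] sym[of u x] refl[of x] e by auto
    qed
    then have "?h = g" using e by (intro min) (auto simp: Delta_def)
    then show False using e by (auto simp: fun_eq_iff split: if_splits)
  qed
qed

lemma inj_hull_below_Delta:
  assumes sym: "\<And>x y. d x y = d y x" and refl: "\<And>x. d x x = 0" and f: "f \<in> Delta d"
  obtains g where "g \<in> inj_hull d" "\<And>x. g x \<le> f x"
proof -
  define D where "D = {g \<in> Delta d. \<forall>x. g x \<le> f x}"
  \<comment> \<open>The order is reversed: Zorn's lemma yields a maximal element, which is a
    pointwise minimal function.\<close>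
  define P :: "('a \<Rightarrow> real) \<Rightarrow> ('a \<Rightarrow> real) \<Rightarrow> bool" where "P g h \<longleftrightarrow> (\<forall>x. h x \<le> g x)" for g h
  have nonneg: "0 \<le> g x" if "g \<in> D" for g x
  proof -
    have "d x x \<le> g x + g x" using that unfolding D_def Delta_def by blast
    then show ?thesis using refl[of x] by simp
  qed
  have "partial_order_on D (relation_of P D)"
    by (rule partial_order_on_relation_ofI) (auto simp: P_def fun_eq_iff intro: order_trans order_antisym)
  moreover have "\<exists>u\<in>D. \<forall>g\<in>C. P g u" if C: "C \<in> Chains (relation_of P D)" for C
  proof (cases "C = {}")
    case True
    then show ?thesis using f by (intro bexI[of _ f]) (auto simp: D_def)
  next
    case False
    have CD: "C \<subseteq> D" using C by (auto simp: Chains_def relation_of_def)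
    have tot: "P g h \<or> P h g" if "g \<in> C" "h \<in> C" for g h
      using C that by (auto simp: Chains_def relation_of_def)
    let ?u = "\<lambda>x. INF g\<in>C. g x"
    have bdd: "bdd_below ((\<lambda>g. g x) ` C)" for x
      using CD nonneg by (intro bdd_belowI2[of _ 0]) auto
    have lower: "?u x \<le> g x" if "g \<in> C" for g x
      by (rule cINF_lower[OF bdd that])
    have "d x y \<le> ?u x + ?u y" for x y
    proof -
      \<comment> \<open>The values at \<open>x\<close> and \<open>y\<close> may come from two
        members of the chain; the smaller of the two functions serves at both points.\<close>
      have "d x y - g x \<le> ?u y" if g: "g \<in> C" for g
      proof (rule cINF_greatest[OF False])
        fix h assume h: "h \<in> C"
        have D: "d x y \<le> k x + k y" if "k \<in> C" for k
          using that CD by (auto simp: D_def Delta_def)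
        show "d x y - g x \<le> h y"
        proof (cases "P g h")
          case True
          then have "h x \<le> g x" by (simp add: P_def)
          then show ?thesis using D[OF h] by simp
        next
          case False
          then have "g y \<le> h y" using tot[OF g h] unfolding P_def by blast
          then show ?thesis using D[OF g] by simp
        qed
      qed
      then have "d x y - ?u y \<le> ?u x"
        by (intro cINF_greatest[OF False]) (simp add: algebra_simps)
      then show ?thesis by simp
    qed
    moreover obtain g where "g \<in> C" using False by blast
    then have "?u x \<le> f x" for x
      using lower[of g x] CD by (auto simp: D_def intro: order_trans)
    ultimately have "?u \<in> D" by (simp add: D_def Delta_def)
    moreover have "\<forall>g\<in>C. P g ?u" using lower by (simp add: P_def)
    ultimately show ?thesis by (intro bexI[of _ ?u])
  qed
  ultimately obtain g where g: "g \<in> D" "\<And>h. h \<in> D \<Longrightarrow> P g h \<Longrightarrow> h = g"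
    using predicate_Zorn[of D P] by blast
  have "h = g" if "h \<in> Delta d" "\<And>x. h x \<le> g x" for h
    using that g(1) by (intro g(2)) (auto simp: D_def P_def intro: order_trans)
  then have "g \<in> inj_hull d"
    using g(1) by (intro Delta_minimal_in_inj_hull sym refl) (auto simp: D_def)
  then show ?thesis using that[of g] g(1) by (simp add: D_def)
qed

text \<open>The bounds \<open>v\<close> at the points \<open>p\<close> are extended to all of X by
  the minimum of \<open>v + d x p\<close>, which lies in \<Delta> by the triangle inequality; a hull
  element below it is then taken. Using pairs instead of a function permits coinciding points with
  different bounds.\<close>

lemma inj_hull_below_finite:
  assumes d: "pseudometric d" and K: "finite K" "K \<noteq> {}"
    and le: "\<And>p v q w. (p, v) \<in> K \<Longrightarrow> (q, w) \<in> K \<Longrightarrow> d p q \<le> v + w"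
  obtains g where "g \<in> inj_hull d" "\<And>p v. (p, v) \<in> K \<Longrightarrow> g p \<le> v"
proof -
  define h where "h x = (MIN (p, v)\<in>K. v + d x p)" for x
  have mem: "\<exists>p v. (p, v) \<in> K \<and> h x = v + d x p" for x
  proof -
    have "h x \<in> (\<lambda>(p, v). v + d x p) ` K" unfolding h_def using K by (intro Min_in) auto
    then show ?thesis by auto
  qed
  have lower: "h x \<le> v + d x p" if "(p, v) \<in> K" for x p v
    unfolding h_def using K that by (intro Min_le) (auto intro!: image_eqI[of _ _ "(p, v)"])
  have "d x y \<le> h x + h y" for x y
  proof -
    obtain p v q w where "(p, v) \<in> K" "h x = v + d x p" "(q, w) \<in> K" "h y = w + d y q"
      using mem[of x] mem[of y] by blast
    then show ?thesis
      using le[of p v q w] pseudometricD(4)[OF d, of x y p] pseudometricD(4)[OF d, of p y q]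
        pseudometricD(3)[OF d, of q y] by simp
  qed
  then have "h \<in> Delta d" by (simp add: Delta_def)
  then obtain g where g: "g \<in> inj_hull d" "\<And>x. g x \<le> h x"
    using inj_hull_below_Delta[where d = d, OF pseudometricD(3,1)[OF d]] by blast
  have "g p \<le> v" if "(p, v) \<in> K" for p v
    using g(2)[of p] lower[OF that, of p] pseudometricD(1)[OF d, of p] by simp
  then show ?thesis using that g(1) by blast
qed

lemma inj_hull_tight_on_maximal_pairs:
  assumes d: "pseudometric d"
    and max: "d x z + d y w \<le> d x y + d z w" "d x w + d y z \<le> d x y + d z w"
  obtains f where "f \<in> inj_hull d" "f x + f y + f z + f w \<le> d x y + d z w"
proof -
  note D = pseudometricD[OF d]
  text \<open>The value \<open>s\<close> at \<open>x\<close> is the Gromov product of \<open>z\<close> and \<open>w\<close> at \<open>x\<close>, the smallest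
    one compatible with equality on both pairs.\<close>
  define s where "s = (d x z + d x w - d z w) / 2"
  \<comment> \<open>This makes \<open>x, z\<close> tight, and by the choice of \<open>s\<close> then
    also \<open>x, w\<close>. The inequalities for \<open>y, z\<close> and \<open>y, w\<close> are
    exactly the two maximality assumptions.\<close>
  define u where "u = d x z - s"
  have "finite {(x, s), (y, d x y - s), (z, u), (w, d z w - u)}"
    "{(x, s), (y, d x y - s), (z, u), (w, d z w - u)} \<noteq> {}" by auto
  moreover have "d p q \<le> v + v'"
    if "(p, v) \<in> {(x, s), (y, d x y - s), (z, u), (w, d z w - u)}"
      "(q, v') \<in> {(x, s), (y, d x y - s), (z, u), (w, d z w - u)}" for p v q v'
  proof -
    have s: "2 * s = d x z + d x w - d z w" by (simp add: s_def)
    have u: "2 * u = d x z - d x w + d z w" using s by (simp add: u_def)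
    have "0 \<le> s" using s D(4)[of z w x] D(3)[of x z] by simp
    moreover have "s \<le> d x y"
      using s D(4)[of x z y] D(4)[of x w y] max by simp
    moreover have "0 \<le> u" using u D(4)[of x w z] by simp
    moreover have "u \<le> d z w" using u D(4)[of x z w] D(3)[of z w] by simp
    moreover have "d x z \<le> s + u" by (simp add: u_def)
    moreover have "d x w \<le> s + (d z w - u)" using s u by simp
    moreover have "d y z \<le> (d x y - s) + u" using s u max by simp
    moreover have "d y w \<le> (d x y - s) + (d z w - u)" using s u max by simp
    ultimately show ?thesis
      using that D(1)[of x] D(1)[of y] D(1)[of z] D(1)[of w] D(3)[of y x] D(3)[of z x] D(3)[of z y]
        D(3)[of w x] D(3)[of w y] D(3)[of w z]
      by (elim insertE emptyE) simp_all
  qed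
  ultimately obtain f where f: "f \<in> inj_hull d"
    "\<And>p v. (p, v) \<in> {(x, s), (y, d x y - s), (z, u), (w, d z w - u)} \<Longrightarrow> f p \<le> v"
    using inj_hull_below_finite[OF d] by metis
  have "f x \<le> s" "f y \<le> d x y - s" "f z \<le> u" "f w \<le> d z w - u"
    using f(2) by auto
  then show ?thesis using that f(1) by simp
qed

lemma inj_hull_four_points:
  assumes d: "pseudometric d"
  obtains f where "f \<in> inj_hull d"
    "f a + f a' + f b + f b' \<le> max (d a b + d a' b') (max (d a' b + d a b') (d a a' + d b b'))"
proof -
  note D = pseudometricD(3)[OF d]
  consider "d a' b + d a b' \<le> d a b + d a' b'" "d a a' + d b b' \<le> d a b + d a' b'"
    | "d a b + d a' b' \<le> d a b' + d a' b" "d a a' + d b b' \<le> d a b' + d a' b"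
    | "d a b + d a' b' \<le> d a a' + d b b'" "d a b' + d a' b \<le> d a a' + d b b'"
    by linarith
  then show ?thesis
  proof cases
    case 1
    then obtain f where "f \<in> inj_hull d" "f a + f b + f a' + f b' \<le> d a b + d a' b'"
      using inj_hull_tight_on_maximal_pairs[OF d, of a a' b b'] D[of b a'] by auto
    then show ?thesis by (intro that[of f]) auto
  next
    case 2
    then obtain f where "f \<in> inj_hull d" "f a + f b' + f a' + f b \<le> d a b' + d a' b"
      using inj_hull_tight_on_maximal_pairs[OF d, of a a' b' b] D[of b' a'] D[of b' b] by auto
    then show ?thesis by (intro that[of f]) auto
  next
    case 3
    then obtain f where "f \<in> inj_hull d" "f a + f a' + f b + f b' \<le> d a a' + d b b'"
      using inj_hull_tight_on_maximal_pairs[OF d, of a b a' b'] by auto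
    then show ?thesis by (intro that[of f]) auto
  qed
qed

section \<open>The converse: a hull decomposition bounds the coefficient\<close>

lemma isolation_index_ge_of_hull_decomposition:
  assumes d: "pseudometric d" and S: "is_split S" and l: "0 < l"
    and eq: "\<And>x y. d x y = d1 x y + l * split_dist S x y"
    and hull: "\<And>f. f \<in> inj_hull d \<Longrightarrow>
      \<exists>f1 g. f = (\<lambda>x. f1 x + l * g x) \<and> f1 \<in> inj_hull d1 \<and> g \<in> inj_hull (split_dist S)"
  shows "l \<le> isolation_index d S"
proof -
  obtain A where A: "S = {A, - A}" "A \<noteq> {}" "- A \<noteq> {}" "split_dist S = cut_dist A"
    by (rule is_splitE[OF S])
  have "isolated d A l"
    unfolding isolated_def
  proof (intro allI impI)
    fix a a' b b'
    assume sides: "(a \<in> A \<longleftrightarrow> a' \<in> A) \<and> (b \<in> A \<longleftrightarrow> b' \<in> A) \<and> (a \<in> A \<longleftrightarrow> b \<notin> A)"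
    obtain f where f: "f \<in> inj_hull d"
      "f a + f a' + f b + f b' \<le> max (d a b + d a' b') (max (d a' b + d a b') (d a a' + d b b'))"
      by (rule inj_hull_four_points[OF d])
    obtain f1 g where fg: "f = (\<lambda>x. f1 x + l * g x)" "f1 \<in> Delta d1" "g \<in> Delta (cut_dist A)"
      using hull[OF f(1)] A(4) by (auto simp: inj_hull_iff)
    have "d a a' + d b b' = d1 a a' + d1 b b'"
      using sides by (auto simp: eq A(4) cut_dist_def)
    also have "\<dots> \<le> f1 a + f1 a' + (f1 b + f1 b')"
      using fg(2) by (intro add_mono) (auto simp: Delta_def)
    finally have 1: "d a a' + d b b' \<le> f1 a + f1 a' + f1 b + f1 b'" by simp
    \<comment> \<open>The cut separates \<open>a\<close> from \<open>b\<close> and \<open>a'\<close>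
      from \<open>b'\<close>, so \<open>g\<close> has total at least 2 on the four points.\<close>
    have "cut_dist A a b + cut_dist A a' b' \<le> g a + g b + (g a' + g b')"
      using fg(3) by (intro add_mono) (auto simp: Delta_def)
    then have "2 \<le> g a + g a' + g b + g b'" using sides by (auto simp: cut_dist_def)
    then have "l * 2 \<le> l * (g a + g a' + g b + g b')" using l by (intro mult_left_mono) auto
    then have "2 * l + d a a' + d b b' \<le> f a + f a' + f b + f b'"
      using 1 by (simp add: fg(1) algebra_simps)
    \<comment> \<open>As \<open>l\<close> is positive, the sum \<open>d a a' + d b b'\<close> cannot
      attain the bound on \<open>f\<close>, so it drops out of the maximum.\<close>
    then show "2 * l + d a a' + d b b' \<le> max (d a b + d a' b') (d a' b + d a b')"
      using f(2) l by linarith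
  qed
  then show ?thesis
    using le_isolation_index_iff[where d = d, OF A(1-3) pseudometricD(3)[OF d] l] by simp
qed

theorem corollary1p4:
  fixes d :: "'a \<Rightarrow> 'a \<Rightarrow> real" and \<S> :: "'a set set set" and \<alpha> :: "'a set set \<Rightarrow> real"
  assumes "Metric_space UNIV d"
    and "\<forall>x y. d x y \<in> \<int>"
    and "local_rank_condition d"
    and "\<S> = {S. d_split d S}"
    and "\<alpha> = isolation_index d"
  shows "(\<exists>d0. split_prime d0 \<and>
            (\<forall>x y. ((\<lambda>S. \<alpha> S * split_dist S x y) has_sum (d x y - d0 x y)) \<S>)) \<and>
         (\<forall>l d1. (\<forall>S\<in>\<S>. l S \<in> {0..\<alpha> S}) \<and>
            d1 = (\<lambda>x y. d x y - (\<Sum>\<^sub>\<infinity>S\<in>\<S>. l S * split_dist S x y)) \<longrightarrow>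
            inj_hull d \<subseteq> real_functions_in (hull_sum d1 \<S> l)) \<and>
         (\<forall>S l d1. is_split S \<and> l > 0 \<and> pseudometric d1 \<and>
            (\<forall>x y. d x y = d1 x y + l * split_dist S x y) \<and>
            inj_hull d \<subseteq> {\<lambda>x. f1 x + l * f x | f1 f.
                               f1 \<in> inj_hull d1 \<and> f \<in> inj_hull (split_dist S)} \<longrightarrow>
            d_split d S \<and> l \<le> \<alpha> S)"
proof (intro conjI allI impI)
  interpret Metric_space UNIV d by fact
  have d: "pseudometric d"
    unfolding pseudometric_def by (simp add: commute triangle)
  have int: "\<And>x y. d x y \<in> \<int>" using assms(2) by blast
  have \<S>: "\<S> = Collect (d_split d)" using assms(4) by simp
  have \<alpha>: "0 \<le> \<alpha> S \<and> \<alpha> S \<le> isolation_index d S" if "d_split d S" for S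
    using that assms(5) by (simp add: d_split_def)
  \<comment> \<open>The split-prime part is the remainder for the maximal coefficients
    \<open>\<alpha>\<close>.\<close>
  show "\<exists>d0. split_prime d0 \<and>
      (\<forall>x y. ((\<lambda>S. \<alpha> S * split_dist S x y) has_sum (d x y - d0 x y)) \<S>)"
    using split_prime_split_subtract_all[OF d int \<alpha> assms(5)]
      split_subtract_all_has_sum[OF d int \<alpha>] unfolding \<S> by blast
  show "inj_hull d \<subseteq> real_functions_in (hull_sum d1 \<S> l)"
    if h: "(\<forall>S\<in>\<S>. l S \<in> {0..\<alpha> S}) \<and>
      d1 = (\<lambda>x y. d x y - (\<Sum>\<^sub>\<infinity>S\<in>\<S>. l S * split_dist S x y))" for l d1
  proof
    fix f assume f: "f \<in> inj_hull d"
    have l: "0 \<le> l S \<and> l S \<le> isolation_index d S" if "d_split d S" for S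
      using h that \<S> assms(5) by auto
    have "d1 = split_subtract d l \<S>"
      using h by (simp add: split_subtract_def fun_eq_iff)
    then show "f \<in> real_functions_in (hull_sum d1 \<S> l)"
      using inj_hull_subset_hull_sum[OF d int l f] \<S> by simp
  qed
  fix S and l :: real and d1
  assume h: "is_split S \<and> l > 0 \<and> pseudometric d1 \<and>
    (\<forall>x y. d x y = d1 x y + l * split_dist S x y) \<and>
    inj_hull d \<subseteq> {\<lambda>x. f1 x + l * f x | f1 f. f1 \<in> inj_hull d1 \<and> f \<in> inj_hull (split_dist S)}"
  then have "is_split S" "0 < l" by simp_all
  moreover have "l \<le> isolation_index d S"
  proof (rule isolation_index_ge_of_hull_decomposition[OF d \<open>is_split S\<close> \<open>0 < l\<close>, of d1])
    show "d x y = d1 x y + l * split_dist S x y" for x y using h by blast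
    show "\<exists>f1 g. f = (\<lambda>x. f1 x + l * g x) \<and> f1 \<in> inj_hull d1 \<and> g \<in> inj_hull (split_dist S)"
      if "f \<in> inj_hull d" for f using h that by blast
  qed
  ultimately show "d_split d S" "l \<le> \<alpha> S"
    by (simp_all add: d_split_def assms(5))
qed

end
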